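(* Let $n\in\mathbb{N}$, let $S_1,\ldots,S_n$ be finite semigroups, let $S=\prod_{i=1}^n S_i$ be their direct product, and let $C=\{i\in\{1,\ldots,n\}: S_i\text{ is commutative}\}$ and $\mathit{NC}=\{i\in\{1,\ldots,n\}: S_i\text{ is not commutative}\}$. Suppose that $\mathit{NC}\neq\emptyset$. Then $$\chi(\mathcal{G}(S))\leqslant\Bigl(\prod_{i\in C}|S_i|\Bigr)\Bigl(\prod_{i\in\mathit{NC}}\bigl(|Z(S_i)|+\chi(\mathcal{G}(S_i))\bigr)\Bigr)-\prod_{i=1}^n|Z(S_i)|.$$
   Context: Semigroups are non-empty. The direct product $\prod_{i=1}^n S_i$ is the cartesian product with componentwise multiplication. The center of a semigroup $T$ is $Z(T)=\{x\in T: xy=yx \text{ for all } y\in T\}$ (possibly empty). For a finite non-commutative semigroup $T$, the commuting graph $\mathcal{G}(T)$ is the simple graph with vertex set $T\setminus Z(T)$ in which two distinct vertices $x,y$ are adjacent if and only if $xy=yx$. $\chi(G)$ denotes the chromatic number of a simple graph $G$ (the minimum number of colours needed to colour the vertices so that adjacent vertices have different colours). An empty product equals $1$. *)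

theory Defs
  imports "HOL-Algebra.Congruence" "HOL-Library.FuncSet" "Graph_Theory.Pair_Digraph"
begin

record 'a semigroup_str = "'a partial_object" +
  sg_mult :: "'a \<Rightarrow> 'a \<Rightarrow> 'a" (infixl \<open>\<odot>\<index>\<close> 70)

locale carrier_semigroup =
  fixes S :: "'a semigroup_str" (structure)
  assumes nonempty: "carrier S \<noteq> {}"
    and closed: "\<lbrakk>x \<in> carrier S; y \<in> carrier S\<rbrakk> \<Longrightarrow> x \<odot> y \<in> carrier S"
    and assoc: "\<lbrakk>x \<in> carrier S; y \<in> carrier S; z \<in> carrier S\<rbrakk>
      \<Longrightarrow> (x \<odot> y) \<odot> z = x \<odot> (y \<odot> z)"

definition commutative_sg :: "'a semigroup_str \<Rightarrow> bool" where
  "commutative_sg S \<longleftrightarrow> (\<forall>x\<in>carrier S. \<forall>y\<in>carrier S. x \<odot>\<^bsub>S\<^esub> y = y \<odot>\<^bsub>S\<^esub> x)"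

definition center :: "'a semigroup_str \<Rightarrow> 'a set" where
  "center S = {x \<in> carrier S. \<forall>y\<in>carrier S. x \<odot>\<^bsub>S\<^esub> y = y \<odot>\<^bsub>S\<^esub> x}"

definition direct_product :: "'i set \<Rightarrow> ('i \<Rightarrow> 'a semigroup_str) \<Rightarrow> ('i \<Rightarrow> 'a) semigroup_str" where
  "direct_product I S =
     \<lparr>carrier = (\<Pi>\<^sub>E i\<in>I. carrier (S i)),
      sg_mult = (\<lambda>x y. \<lambda>i\<in>I. x i \<odot>\<^bsub>S i\<^esub> y i)\<rparr>"

text \<open>A simple graph is encoded as a loopless symmetric digraph: each edge \<open>{x, y}\<close> is
  represented by the two arcs \<open>(x, y)\<close> and \<open>(y, x)\<close>.\<close>

definition commuting_graph :: "'a semigroup_str \<Rightarrow> 'a pair_pre_digraph" where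
  "commuting_graph S =
     \<lparr>pverts = carrier S - center S,
      parcs = {(x, y). x \<in> carrier S - center S \<and> y \<in> carrier S - center S
                       \<and> x \<noteq> y \<and> x \<odot>\<^bsub>S\<^esub> y = y \<odot>\<^bsub>S\<^esub> x}\<rparr>"

definition proper_colouring :: "'v pair_pre_digraph \<Rightarrow> nat \<Rightarrow> ('v \<Rightarrow> nat) \<Rightarrow> bool" where
  "proper_colouring G k c \<longleftrightarrow>
     c ` pverts G \<subseteq> {..<k} \<and> (\<forall>(x, y)\<in>parcs G. c x \<noteq> c y)"

text \<open>Meaningful for graphs with a finite proper colouring, in particular for finite simple graphs
  (see \<open>ex_proper_colouring\<close>); otherwise \<open>LEAST\<close> is unspecified.\<close>

definition chromatic_number :: "'v pair_pre_digraph \<Rightarrow> nat" where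
  "chromatic_number G = (LEAST k. \<exists>c. proper_colouring G k c)"

lemma carrier_semigroup_direct_product:
  assumes "\<And>i. i \<in> I \<Longrightarrow> carrier_semigroup (S i)"
  shows "carrier_semigroup (direct_product I S)"
proof
  show "carrier (direct_product I S) \<noteq> {}"
    using assms by (auto simp: direct_product_def PiE_eq_empty_iff carrier_semigroup.nonempty)
next
  fix x y
  assume "x \<in> carrier (direct_product I S)" "y \<in> carrier (direct_product I S)"
  then show "x \<odot>\<^bsub>direct_product I S\<^esub> y \<in> carrier (direct_product I S)"
    using assms by (auto simp: direct_product_def PiE_iff intro!: carrier_semigroup.closed)
next
  fix x y z
  assume "x \<in> carrier (direct_product I S)" "y \<in> carrier (direct_product I S)"
    "z \<in> carrier (direct_product I S)"
  then show "(x \<odot>\<^bsub>direct_product I S\<^esub> y) \<odot>\<^bsub>direct_product I S\<^esub> z =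
      x \<odot>\<^bsub>direct_product I S\<^esub> (y \<odot>\<^bsub>direct_product I S\<^esub> z)"
    using assms
    by (auto simp: direct_product_def PiE_iff carrier_semigroup.assoc intro!: restrict_ext)
qed

lemma pair_graph_commuting_graph:
  assumes "finite (carrier S)"
  shows "pair_graph (commuting_graph S)"
proof
  show "finite (pverts (commuting_graph S))"
    using assms by (simp add: commuting_graph_def)
  show "finite (parcs (commuting_graph S))"
    by (rule finite_subset[of _ "carrier S \<times> carrier S"])
       (use assms in \<open>auto simp: commuting_graph_def\<close>)
  show "symmetric (with_proj (commuting_graph S))"
    by (auto simp: symmetric_def sym_def commuting_graph_def)
qed (auto simp: commuting_graph_def)

lemma ex_proper_colouring:
  assumes "pair_graph G"
  shows "\<exists>k c. proper_colouring G k c"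
proof -
  interpret pair_graph G by fact
  obtain c where c: "bij_betw c (pverts G) {0..<card (pverts G)}"
    using ex_bij_betw_finite_nat pair_finite_verts by blast
  have "c x \<noteq> c y" if "(x, y) \<in> parcs G" for x y
    using that c in_arcsD1[OF that] in_arcsD2[OF that] pair_no_loops[OF that]
    by (auto simp: bij_betw_def dest: inj_onD)
  then have "proper_colouring G (card (pverts G)) c"
    using c by (auto simp: proper_colouring_def bij_betw_def)
  then show ?thesis by blast
qed

end

theory Submission
  imports Defs
begin

text \<open>
  Colour all elements of a factor \<open>S i\<close>, not just the non-central ones: a central element is its own
  colour, and a non-central one keeps its colour in an optimal colouring of the commuting graph.
  This takes \<open>card (center (S i)) + \<chi> i\<close> colours, where \<open>\<chi> i\<close> is the chromatic number of that graph,
  and distinct commuting elements always get distinct colours. Commutation and equality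
  in the direct product are componentwise, so colouring a tuple by the tuple of colours of its
  components separates distinct commuting tuples.

  A tuple all of whose components have central colours is central, hence not a vertex of the
  commuting graph. So the \<open>\<Prod>i. card (center (S i))\<close> tuples of central colours do not occur,
  which is where the subtracted term comes from. A commutative factor is its own center and its
  commuting graph is empty, so its number of colours is just its order.
\<close>

text \<open>Colourings with an arbitrary finite palette, such as one consisting of tuples, bound the
  chromatic number: enumerating the palette turns them into colourings by numbers.\<close>

lemma chromatic_number_le_card:
  assumes "finite K" and "f ` pverts G \<subseteq> K"
    and "\<And>x y. (x, y) \<in> parcs G \<Longrightarrow> x \<in> pverts G \<and> y \<in> pverts G \<and> f x \<noteq> f y"
  shows "chromatic_number G \<le> card K"
proof -
  obtain h where h: "bij_betw h K {0..<card K}"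
    using ex_bij_betw_finite_nat[OF \<open>finite K\<close>] by blast
  have "h (f x) \<noteq> h (f y)" if "(x, y) \<in> parcs G" for x y
  proof -
    have "f x \<in> K" "f y \<in> K" "f x \<noteq> f y"
      using assms(2) assms(3)[OF that] by auto
    then show ?thesis
      using h by (auto simp: bij_betw_def dest: inj_onD)
  qed
  moreover have "(h \<circ> f) ` pverts G \<subseteq> {..<card K}"
    using assms(2) bij_betw_apply[OF h] by fastforce
  ultimately have "proper_colouring G (card K) (h \<circ> f)"
    by (auto simp: proper_colouring_def)
  then show ?thesis
    unfolding chromatic_number_def by (intro Least_le) blast
qed

lemma ex_optimal_colouring:
  assumes "pair_graph G"
  obtains c where "proper_colouring G (chromatic_number G) c"
  using LeastI_ex[OF ex_proper_colouring[OF assms]]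
  unfolding chromatic_number_def by blast

lemma center_eq_carrier_if_commutative:
  "commutative_sg S \<Longrightarrow> center S = carrier S"
  by (auto simp: commutative_sg_def center_def)

lemma chromatic_number_commutative:
  assumes "commutative_sg S"
  shows "chromatic_number (commuting_graph S) = 0"
proof -
  have "chromatic_number (commuting_graph S) \<le> card ({} :: nat set)"
    by (rule chromatic_number_le_card)
       (auto simp: commuting_graph_def center_eq_carrier_if_commutative[OF assms])
  then show ?thesis by simp
qed

text \<open>Keeping the central colours in a summand of their own lets the colour of an element decide
  whether that element is central.\<close>

definition palette :: "'a semigroup_str \<Rightarrow> ('a + nat) set" where
  "palette S = center S <+> {..<chromatic_number (commuting_graph S)}"

definition element_colouring :: "'a semigroup_str \<Rightarrow> ('a \<Rightarrow> 'a + nat) \<Rightarrow> bool" where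
  "element_colouring S d \<longleftrightarrow>
     d \<in> carrier S \<rightarrow> palette S \<and>
     (\<forall>x\<in>carrier S. d x \<in> Inl ` center S \<longrightarrow> x \<in> center S) \<and>
     (\<forall>x\<in>carrier S. \<forall>y\<in>carrier S. x \<noteq> y \<longrightarrow> x \<odot>\<^bsub>S\<^esub> y = y \<odot>\<^bsub>S\<^esub> x \<longrightarrow> d x \<noteq> d y)"

lemma finite_center: "finite (carrier S) \<Longrightarrow> finite (center S)"
  by (auto simp: center_def)

lemma finite_palette: "finite (carrier S) \<Longrightarrow> finite (palette S)"
  by (simp add: palette_def finite_center)

lemma card_palette:
  "finite (carrier S) \<Longrightarrow>
    card (palette S) = card (center S) + chromatic_number (commuting_graph S)"
  by (simp add: palette_def card_Plus finite_center)

lemma ex_element_colouring: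
  assumes "finite (carrier S)"
  shows "\<exists>d. element_colouring S d"
proof -
  obtain c where c: "proper_colouring (commuting_graph S) (chromatic_number (commuting_graph S)) c"
    using ex_optimal_colouring[OF pair_graph_commuting_graph[OF assms]] .
  define d where "d x = (if x \<in> center S then Inl x else Inr (c x))" for x
  have range: "c x < chromatic_number (commuting_graph S)"
    if "x \<in> carrier S" "x \<notin> center S" for x
    using c that by (auto simp: proper_colouring_def commuting_graph_def)
  have proper: "c x \<noteq> c y"
    if "x \<in> carrier S" "x \<notin> center S" "y \<in> carrier S" "y \<notin> center S"
      "x \<noteq> y" "x \<odot>\<^bsub>S\<^esub> y = y \<odot>\<^bsub>S\<^esub> x" for x y
    using c that by (auto simp: proper_colouring_def commuting_graph_def)
  have "element_colouring S d"
    unfolding element_colouring_def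
  proof (intro conjI ballI impI)
    show "d \<in> carrier S \<rightarrow> palette S"
      by (auto simp: d_def palette_def range)
    show "x \<in> center S" if "d x \<in> Inl ` center S" for x
      using that by (auto simp: d_def split: if_splits)
    show "d x \<noteq> d y" if "x \<in> carrier S" "y \<in> carrier S" "x \<noteq> y" "x \<odot>\<^bsub>S\<^esub> y = y \<odot>\<^bsub>S\<^esub> x" for x y
      using proper[of x y] that by (auto simp: d_def)
  qed
  then show ?thesis by blast
qed

lemma carrier_direct_product: "carrier (direct_product I S) = (\<Pi>\<^sub>E i\<in>I. carrier (S i))"
  by (simp add: direct_product_def)

lemma commute_direct_product_iff:
  "x \<odot>\<^bsub>direct_product I S\<^esub> y = y \<odot>\<^bsub>direct_product I S\<^esub> x \<longleftrightarrow>
    (\<forall>i\<in>I. x i \<odot>\<^bsub>S i\<^esub> y i = y i \<odot>\<^bsub>S i\<^esub> x i)"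
  by (auto simp: direct_product_def restrict_def fun_eq_iff)

lemma PiE_center_subset_center_direct_product:
  "(\<Pi>\<^sub>E i\<in>I. center (S i)) \<subseteq> center (direct_product I S)"
  by (auto simp: center_def carrier_direct_product commute_direct_product_iff PiE_iff)

text \<open>The palette for the product is the set of colour tuples that are not entirely central.\<close>

lemma chromatic_number_direct_product_le:
  assumes "finite I" and fin: "\<And>i. i \<in> I \<Longrightarrow> finite (carrier (S i))"
  shows "chromatic_number (commuting_graph (direct_product I S))
    \<le> (\<Prod>i\<in>I. card (palette (S i))) - (\<Prod>i\<in>I. card (center (S i)))"
proof -
  let ?P = "direct_product I S"
  let ?A = "\<Pi>\<^sub>E i\<in>I. palette (S i)"
  let ?B = "\<Pi>\<^sub>E i\<in>I. Inl ` center (S i) :: ('b + nat) set"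
  have "\<forall>i\<in>I. \<exists>d. element_colouring (S i) d"
    using fin ex_element_colouring by blast
  then obtain d where d: "\<And>i. i \<in> I \<Longrightarrow> element_colouring (S i) (d i)"
    by metis
  define f where "f x = (\<lambda>i\<in>I. d i (x i))" for x
  have f_palette: "f x \<in> ?A" if "x \<in> carrier ?P" for x
    using that d by (fastforce simp: f_def carrier_direct_product element_colouring_def PiE_iff)
  have f_central: "x \<in> center ?P" if x: "x \<in> carrier ?P" and "f x \<in> ?B" for x
  proof -
    have "x i \<in> center (S i)" if "i \<in> I" for i
    proof -
      have "d i (x i) \<in> Inl ` center (S i)"
        using PiE_mem[OF \<open>f x \<in> ?B\<close> \<open>i \<in> I\<close>] \<open>i \<in> I\<close> by (simp add: f_def)
      moreover have "x i \<in> carrier (S i)"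
        using x \<open>i \<in> I\<close> by (auto simp: carrier_direct_product)
      ultimately show ?thesis
        using d[OF \<open>i \<in> I\<close>] by (simp add: element_colouring_def)
    qed
    then have "x \<in> (\<Pi>\<^sub>E i\<in>I. center (S i))"
      using x by (auto simp: carrier_direct_product PiE_iff)
    then show ?thesis
      using PiE_center_subset_center_direct_product by blast
  qed
  have f_proper: "f x \<noteq> f y"
    if x: "x \<in> carrier ?P" and y: "y \<in> carrier ?P" and "x \<noteq> y"
      and comm: "x \<odot>\<^bsub>?P\<^esub> y = y \<odot>\<^bsub>?P\<^esub> x" for x y
  proof -
    obtain i where i: "i \<in> I" "x i \<noteq> y i"
      using x y \<open>x \<noteq> y\<close> unfolding carrier_direct_product by (metis PiE_ext)
    have "x i \<in> carrier (S i)" "y i \<in> carrier (S i)"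
      using x y i by (auto simp: carrier_direct_product)
    then have "d i (x i) \<noteq> d i (y i)"
      using d[OF i(1)] i comm by (simp add: element_colouring_def commute_direct_product_iff)
    then show ?thesis
      using i(1) by (auto simp: f_def fun_eq_iff)
  qed
  have finA: "finite ?A"
    using \<open>finite I\<close> fin by (intro finite_PiE) (auto intro: finite_palette)
  have "?B \<subseteq> ?A"
    by (intro PiE_mono) (auto simp: palette_def)
  have "chromatic_number (commuting_graph ?P) \<le> card (?A - ?B)"
  proof (rule chromatic_number_le_card)
    show "finite (?A - ?B)"
      using finA by simp
    show "f ` pverts (commuting_graph ?P) \<subseteq> ?A - ?B"
      using f_palette f_central by (auto simp: commuting_graph_def)
    show "x \<in> pverts (commuting_graph ?P) \<and> y \<in> pverts (commuting_graph ?P) \<and> f x \<noteq> f y"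
      if "(x, y) \<in> parcs (commuting_graph ?P)" for x y
      using that f_proper by (auto simp: commuting_graph_def)
  qed
  also have "\<dots> = card ?A - card ?B"
    using \<open>?B \<subseteq> ?A\<close> finA by (intro card_Diff_subset) (auto intro: finite_subset)
  also have "\<dots> = (\<Prod>i\<in>I. card (palette (S i))) - (\<Prod>i\<in>I. card (center (S i)))"
    using \<open>finite I\<close> by (simp add: card_PiE card_image)
  finally show ?thesis .
qed

theorem theorem4p7:
  fixes n :: nat and S :: "nat \<Rightarrow> 'a semigroup_str" and C NC :: "nat set"
  assumes "\<And>i. i \<in> {1..n} \<Longrightarrow> carrier_semigroup (S i)"
    and "\<And>i. i \<in> {1..n} \<Longrightarrow> finite (carrier (S i))"
    and "C = {i \<in> {1..n}. commutative_sg (S i)}"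
    and "NC = {i \<in> {1..n}. \<not> commutative_sg (S i)}"
    and "NC \<noteq> {}"
  shows "int (chromatic_number (commuting_graph (direct_product {1..n} S)))
    \<le> int ((\<Prod>i\<in>C. card (carrier (S i))) *
           (\<Prod>i\<in>NC. card (center (S i)) + chromatic_number (commuting_graph (S i))))
      - int (\<Prod>i=1..n. card (center (S i)))"
proof -
  let ?m = "\<lambda>i. card (palette (S i))"
  have m: "?m i = card (center (S i)) + chromatic_number (commuting_graph (S i))"
    if "i \<in> {1..n}" for i
    using assms(2)[OF that] by (rule card_palette)
  have split: "{1..n} = C \<union> NC" "C \<inter> NC = {}" "finite C" "finite NC"
    unfolding assms(3,4) by auto
  have "(\<Prod>i=1..n. ?m i) = (\<Prod>i\<in>C. ?m i) * (\<Prod>i\<in>NC. ?m i)"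
    unfolding split(1) by (rule prod.union_disjoint) (use split in auto)
  also have "(\<Prod>i\<in>C. ?m i) = (\<Prod>i\<in>C. card (carrier (S i)))"
    by (rule prod.cong)
       (auto simp: assms(3) m chromatic_number_commutative center_eq_carrier_if_commutative)
  also have "(\<Prod>i\<in>NC. ?m i) =
      (\<Prod>i\<in>NC. card (center (S i)) + chromatic_number (commuting_graph (S i)))"
    by (rule prod.cong) (auto simp: assms(4) m)
  finally have product: "(\<Prod>i=1..n. ?m i) = (\<Prod>i\<in>C. card (carrier (S i))) *
      (\<Prod>i\<in>NC. card (center (S i)) + chromatic_number (commuting_graph (S i)))" .
  \<comment> \<open>This makes the truncated difference of natural numbers agree with the integer one.\<close>
  have le: "(\<Prod>i=1..n. card (center (S i))) \<le> (\<Prod>i=1..n. ?m i)"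
    by (intro prod_mono) (simp add: m)
  have "chromatic_number (commuting_graph (direct_product {1..n} S))
      \<le> (\<Prod>i=1..n. ?m i) - (\<Prod>i=1..n. card (center (S i)))"
    using assms(2) by (intro chromatic_number_direct_product_le) auto
  then have "int (chromatic_number (commuting_graph (direct_product {1..n} S)))
      \<le> int (\<Prod>i=1..n. ?m i) - int (\<Prod>i=1..n. card (center (S i)))"
    using le by linarith
  then show ?thesis
    unfolding product .
qed

end
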